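(* Let $\sigma\subseteq\tau$ be topologies on a set $X$ with $\tau$ semiregular. Let $\kappa$ be an infinite cardinal such that $\tau$ is $\kappa$-Baire, and let $1\leq\alpha\leq\kappa$ be an ordinal. Assume that $\tau$ has a neighborhood basis consisting of sets in $\bigcup_{\xi<\alpha}\mathbf{\Pi}^{\kappa,0}_{1+\xi}$ with respect to $\sigma$. (i) If $\alpha$ is a successor ordinal and $(\tau_\xi)_{\xi\leq\alpha}$ is a filtration from $\sigma$ to $\tau$, then $\tau=\tau_\alpha$. (ii) If $\alpha$ is a limit ordinal and $(\tau_\xi)_{\xi<\alpha}$ is a filtration from $\sigma$ to $\tau$, then $\tau=\bigvee_{\xi<\alpha}\tau_\xi$.
   Context: All topologies are on a fixed set $X$; $\mathrm{int}_\tau$ denotes interior with respect to $\tau$. Filtration: for topologies $\sigma\subseteq\tau$ and an ordinal $\rho$, a transfinite sequence of topologies $(\tau_\xi)_{\xi<\rho}$ is a filtration from $\sigma$ to $\tau$ if $\sigma=\tau_0\subseteq\tau_1\subseteq\cdots\subseteq\tau_\xi\subseteq\cdots\subseteq\tau$ (increasing, starting at $\sigma$, all contained in $\tau$) and, for each $\alpha<\rho$, if $F$ is $\tau_\xi$-closed for some $\xi<\alpha$, then $\mathrm{int}_{\tau_\alpha}(F)=\mathrm{int}_\tau(F)$. We write $(\tau_\xi)_{\xi\leq\rho}$ for $(\tau_\xi)_{\xi<\rho+1}$. Join: for a family $S$ of topologies, $\bigvee S$ is the smallest topology containing each topology in $S$. Neighborhood basis of $\tau$: a family $\mathcal{A}$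 of subsets of $X$ (not necessarily open) such that for each $x\in X$ and each $\tau$-open $B\ni x$ there is $A\in\mathcal{A}$ with $x\in\mathrm{int}_\tau(A)$ and $A\subseteq B$. $\kappa$-Baire: a set is $\kappa$-meager (with respect to $\tau$) if it is the union of $<\kappa$ many $\tau$-nowhere dense sets; $\tau$ is $\kappa$-Baire if the complement of each $\kappa$-meager set is $\tau$-dense. Semiregular: a topology is semiregular if it is generated by its regular open sets, i.e. sets equal to the interior of their closure (equivalently, each open set is a union of interiors of closed sets). Borel classes (with respect to a given topology): for a cardinal $\nu>0$ (possibly finite) with cardinal successor $\nu^+$, let $\mathbf{P}^\nu_0$ be the family of all closed sets and, for $0<\xi<\nu^+$, let $\mathbf{P}^\nu_\xi$ consist of intersections of subfamilies of cardinality $\leq\nu$ of complements of sets in $\bigcup_{\gamma<\xi}\mathbf{P}^\nu_\gamma$. For an ordinal $\xi<\kappa$, $\mathbf{\Pi}^{\kappa,0}_{1+\xi}=\bigcup\{\mathbf{P}^\nu_\xi\mid\nu\text{ a cardinal},\ \nu<\kappa,\ \xi<\nu^+\}$. "With respect to $\sigma$" means these are computed starting from the $\sigma$-closed sets. *)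

theory Defs
  imports "HOL-Analysis.Abstract_Topology"
begin

unbundle cardinal_syntax

text \<open>
  Ordinals are the points of an arbitrary type \<open>'i\<close> of class \<^class>\<open>wellorder\<close>; the point \<open>\<xi>\<close>
  stands for the order type of \<open>{..<\<xi>}\<close>. Every ordinal occurs as such a point for a suitable \<open>'i\<close>.
  Cardinals are \<^const>\<open>Card_order\<close> relations. A set \<open>X\<close> with a topology is the \<^const>\<open>topspace\<close>
  of a \<open>'a topology\<close>.
\<close>

definition ord_rel :: "'i::wellorder \<Rightarrow> 'i rel"
  where "ord_rel \<xi> = {(\<beta>, \<gamma>). \<beta> \<le> \<gamma> \<and> \<gamma> < \<xi>}"

definition ord0 :: "'i::wellorder"
  where "ord0 = (LEAST \<xi>. True)"

definition successor_ord :: "'i::wellorder \<Rightarrow> bool"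
  where "successor_ord \<alpha> \<longleftrightarrow> (\<exists>\<beta><\<alpha>. \<forall>\<gamma><\<alpha>. \<gamma> \<le> \<beta>)"

definition limit_ord :: "'i::wellorder \<Rightarrow> bool"
  where "limit_ord \<alpha> \<longleftrightarrow> ord0 < \<alpha> \<and> \<not> successor_ord \<alpha>"

definition coarser :: "'a topology \<Rightarrow> 'a topology \<Rightarrow> bool"
  where "coarser \<sigma> \<tau> \<longleftrightarrow>
    topspace \<sigma> = topspace \<tau> \<and> (\<forall>U. openin \<sigma> U \<longrightarrow> openin \<tau> U)"

text \<open>
  The length \<open>\<rho> > 0\<close> of a filtration is given by the initial segment \<open>I\<close> of its indices:
  \<open>{..<\<alpha>}\<close> for \<open>\<rho> = \<alpha>\<close> and \<open>{..\<alpha>}\<close> for \<open>\<rho> = \<alpha> + 1\<close>. Values of \<open>T\<close> outside \<open>I\<close> are irrelevant.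
\<close>

definition filtration ::
    "'a topology \<Rightarrow> 'a topology \<Rightarrow> 'i::wellorder set \<Rightarrow> ('i \<Rightarrow> 'a topology) \<Rightarrow> bool"
  where "filtration \<sigma> \<tau> I T \<longleftrightarrow>
    T ord0 = \<sigma> \<and>
    (\<forall>\<xi>\<in>I. \<forall>\<eta>\<in>I. \<xi> \<le> \<eta> \<longrightarrow> coarser (T \<xi>) (T \<eta>)) \<and>
    (\<forall>\<xi>\<in>I. coarser (T \<xi>) \<tau>) \<and>
    (\<forall>\<alpha>\<in>I. \<forall>F. (\<exists>\<xi><\<alpha>. closedin (T \<xi>) F) \<longrightarrow>
      T \<alpha> interior_of F = \<tau> interior_of F)"

text \<open>Adjoining \<open>X\<close> to the generating sets makes the empty join a topology on \<open>X\<close> as well.\<close>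

definition topology_join :: "'a set \<Rightarrow> 'a topology set \<Rightarrow> 'a topology"
  where "topology_join X S = topology_generated_by (insert X (\<Union>\<tau>\<in>S. {U. openin \<tau> U}))"

definition neighborhood_basis :: "'a topology \<Rightarrow> 'a set set \<Rightarrow> bool"
  where "neighborhood_basis \<tau> \<A> \<longleftrightarrow>
    (\<forall>A\<in>\<A>. A \<subseteq> topspace \<tau>) \<and>
    (\<forall>x\<in>topspace \<tau>. \<forall>B. openin \<tau> B \<and> x \<in> B \<longrightarrow>
      (\<exists>A\<in>\<A>. x \<in> \<tau> interior_of A \<and> A \<subseteq> B))"

definition nowhere_dense_in :: "'a topology \<Rightarrow> 'a set \<Rightarrow> bool"
  where "nowhere_dense_in \<tau> N \<longleftrightarrow>
    N \<subseteq> topspace \<tau> \<and> \<tau> interior_of (\<tau> closure_of N) = {}"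

definition kappa_meager :: "'k rel \<Rightarrow> 'a topology \<Rightarrow> 'a set \<Rightarrow> bool"
  where "kappa_meager \<kappa> \<tau> M \<longleftrightarrow>
    (\<exists>\<N>. (\<forall>N\<in>\<N>. nowhere_dense_in \<tau> N) \<and> |\<N>| <o \<kappa> \<and> M = \<Union>\<N>)"

definition kappa_Baire :: "'k rel \<Rightarrow> 'a topology \<Rightarrow> bool"
  where "kappa_Baire \<kappa> \<tau> \<longleftrightarrow>
    (\<forall>M. kappa_meager \<kappa> \<tau> M \<longrightarrow> \<tau> closure_of (topspace \<tau> - M) = topspace \<tau>)"

definition regular_openin :: "'a topology \<Rightarrow> 'a set \<Rightarrow> bool"
  where "regular_openin \<tau> U \<longleftrightarrow> \<tau> interior_of (\<tau> closure_of U) = U"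

definition semiregular :: "'a topology \<Rightarrow> bool"
  where "semiregular \<tau> \<longleftrightarrow> topology_generated_by {U. regular_openin \<tau> U} = \<tau>"

text \<open>
  \<open>borel_P \<sigma> \<nu> \<xi>\<close> is the class \<open>P\<^sup>\<nu>\<^sub>\<xi>\<close>; it is meaningful for \<open>\<nu> > 0\<close> and \<open>\<xi> < \<nu>\<^sup>+\<close> only, which is
  imposed where it is used. The intersection with \<open>X\<close> matters only for the empty subfamily.
\<close>

function borel_P :: "'a topology \<Rightarrow> 'k rel \<Rightarrow> 'i::wellorder \<Rightarrow> 'a set set"
  where "borel_P \<sigma> \<nu> \<xi> =
    (if \<xi> = ord0 then {A. closedin \<sigma> A}
     else {topspace \<sigma> \<inter> \<Inter>\<F> | \<F>.
             \<F> \<subseteq> (\<lambda>B. topspace \<sigma> - B) ` (\<Union>\<gamma>\<in>{..<\<xi>}. borel_P \<sigma> \<nu> \<gamma>) \<and> |\<F>| \<le>o \<nu>})"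
  by pat_completeness auto
termination
  by (relation "inv_image {(\<gamma>, \<xi>). \<gamma> < \<xi>} (\<lambda>(\<sigma>, \<nu>, \<xi>). \<xi>)") (auto simp: wf)

declare borel_P.simps [simp del]

text \<open>
  \<open>borel_Pi \<kappa> \<sigma> \<xi>\<close> is the class with subscript \<open>1 + \<xi>\<close>, so \<open>borel_Pi \<kappa> \<sigma> ord0\<close> consists of the
  closed sets. Taking \<open>\<nu>\<close> on the type underlying \<open>\<kappa>\<close> is no restriction: every cardinal below \<open>\<kappa>\<close> is
  isomorphic to a \<^const>\<open>Card_order\<close> on a subset of \<open>Field \<kappa>\<close>.
\<close>

definition borel_Pi :: "'k rel \<Rightarrow> 'a topology \<Rightarrow> 'i::wellorder \<Rightarrow> 'a set set"
  where "borel_Pi \<kappa> \<sigma> \<xi> =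
    \<Union>{borel_P \<sigma> \<nu> \<xi> | \<nu> :: 'k rel. Cnotzero \<nu> \<and> \<nu> <o \<kappa> \<and> ord_rel \<xi> <o cardSuc \<nu>}"

end

theory Submission
  imports Defs
begin

text \<open>
  The idea is that a set \<open>A\<close> of class \<open>P\<^sup>\<nu>\<^sub>\<xi>\<close> with respect to \<open>\<sigma>\<close> agrees, up to a \<open>\<tau>\<close>-meager error,
  with a set closed in the \<open>\<xi>\<close>-th topology \<open>T \<xi>\<close> of the filtration (lemma
  \<open>borel_P_approx_closed\<close>); the error is covered by so few nowhere dense sets that it is
  \<open>\<kappa>\<close>-meager when \<open>\<nu> < \<kappa>\<close>. This is the analogue of the Baire property of Borel sets. It is proved by
  induction on \<open>\<xi>\<close>: if \<open>B\<close> is approximated by a \<open>T \<gamma>\<close>-closed set \<open>F\<close> and \<open>\<gamma> < \<xi>\<close>, then the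
  complement of \<open>B\<close> is approximated by the complement of \<open>\<tau> interior_of F\<close>, because the boundary of
  \<open>F\<close> is \<open>\<tau>\<close>-nowhere dense; and the filtration condition makes \<open>\<tau> interior_of F\<close> open already in
  \<open>T \<xi>\<close>. Intersections of at most \<open>\<nu>\<close> many sets add up at most \<open>\<nu>\<close> many errors.

  Now let \<open>U\<close> be regular open in \<open>\<tau>\<close> and \<open>x \<in> U\<close>. Choose a basic neighborhood \<open>A \<subseteq> U\<close> of \<open>x\<close> and a
  \<open>T \<xi>\<close>-closed approximation \<open>F\<close> of \<open>A\<close>. Since \<open>\<tau>\<close> is \<open>\<kappa>\<close>-Baire, no nonempty \<open>\<tau>\<close>-open set is
  \<open>\<kappa>\<close>-meager, and the meager errors disappear on the level of open sets:
  \<open>\<tau> interior_of A \<subseteq> F\<close> and \<open>\<tau> interior_of F \<subseteq> \<tau> closure_of A \<subseteq> \<tau> closure_of U\<close>. Hence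
  \<open>\<tau> interior_of F\<close> is a neighborhood of \<open>x\<close>, and by regularity it lies inside \<open>U\<close>. By the filtration
  condition it is open in \<open>T \<eta>\<close> for every index \<open>\<eta> > \<xi>\<close> (lemma
  \<open>regular_open_filtration_neighborhood\<close>). Semiregularity of \<open>\<tau>\<close> then yields both parts: such an
  index \<open>\<eta>\<close> is \<open>\<alpha>\<close> itself in the successor case, and exists below \<open>\<alpha>\<close> in the limit case.
\<close>

section \<open>Sets covered by few nowhere dense sets\<close>

text \<open>
  Finite covers are always allowed, so that also for finite \<open>\<nu>\<close> the covers of \<open>\<nu>\<close> many sets combine
  to a cover of the same kind. Counting against a fixed \<open>\<nu> < \<kappa>\<close> instead of \<open>\<kappa>\<close> avoids a regularity
  assumption: for singular \<open>\<kappa>\<close>, fewer than \<open>\<kappa>\<close> many covers, each of size less than \<open>\<kappa>\<close>, may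
  combine to one of size \<open>\<kappa>\<close>.
\<close>

definition nu_meager :: "'k rel \<Rightarrow> 'a topology \<Rightarrow> 'a set \<Rightarrow> bool"
  where "nu_meager \<nu> \<tau> M \<longleftrightarrow>
    (\<exists>\<N>. (\<forall>N\<in>\<N>. nowhere_dense_in \<tau> N) \<and> (finite \<N> \<or> |\<N>| \<le>o \<nu>) \<and> M \<subseteq> \<Union>\<N>)"

lemma nu_meager_subset: "nu_meager \<nu> \<tau> M \<Longrightarrow> M' \<subseteq> M \<Longrightarrow> nu_meager \<nu> \<tau> M'"
  unfolding nu_meager_def by (meson subset_trans)

lemma nu_meager_empty: "nu_meager \<nu> \<tau> {}"
  unfolding nu_meager_def by (intro exI[of _ "{}"]) simp

lemma nu_meager_nowhere_dense: "nowhere_dense_in \<tau> N \<Longrightarrow> nu_meager \<nu> \<tau> N"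
  unfolding nu_meager_def by (intro exI[of _ "{N}"]) simp

lemma finite_ordLess_Card_order:
  assumes "Card_order r" and "infinite (Field r)" and "finite A"
  shows "|A| <o r"
proof (rule finite_ordLess_infinite)
  show "Well_order r" using assms(1) unfolding card_order_on_def by blast
  show "Well_order |A|" by (rule card_of_Well_order)
qed (use assms in \<open>simp_all add: Field_card_of\<close>)

lemma finite_of_ordLeq_finite_Field:
  assumes "Card_order r" and "finite (Field r)" and "|A| \<le>o r"
  shows "finite A"
proof -
  have "|A| \<le>o |Field r|"
    using assms(3) ordIso_symmetric[OF card_of_Field_ordIso[OF assms(1)]]
    by (rule ordLeq_ordIso_trans)
  then show ?thesis using assms(2) by (rule card_of_ordLeq_finite)
qed

text \<open>
  The count of covering sets is \<open>\<nu> * \<nu> = \<nu>\<close> for infinite \<open>\<nu>\<close>. For finite \<open>\<nu>\<close> every cover involved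
  is finite.
\<close>

lemma nu_meager_UN:
  assumes \<nu>: "Card_order \<nu>" and I: "finite I \<or> |I| \<le>o \<nu>"
    and M: "\<And>i. i \<in> I \<Longrightarrow> nu_meager \<nu> \<tau> (M i)"
  shows "nu_meager \<nu> \<tau> (\<Union>i\<in>I. M i)"
proof -
  have "\<forall>i\<in>I. \<exists>\<N>. (\<forall>N\<in>\<N>. nowhere_dense_in \<tau> N) \<and> (finite \<N> \<or> |\<N>| \<le>o \<nu>) \<and> M i \<subseteq> \<Union>\<N>"
    using M unfolding nu_meager_def by blast
  then obtain \<N> where N: "\<And>i. i \<in> I \<Longrightarrow> \<forall>N\<in>\<N> i. nowhere_dense_in \<tau> N"
      "\<And>i. i \<in> I \<Longrightarrow> finite (\<N> i) \<or> |\<N> i| \<le>o \<nu>" "\<And>i. i \<in> I \<Longrightarrow> M i \<subseteq> \<Union>(\<N> i)"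
    by metis
  have "finite (\<Union>i\<in>I. \<N> i) \<or> |\<Union>i\<in>I. \<N> i| \<le>o \<nu>"
  proof (cases "finite (Field \<nu>)")
    case True
    then show ?thesis using I N(2) by (metis finite_UN_I finite_of_ordLeq_finite_Field[OF \<nu> True])
  next
    case False
    note fin = finite_ordLess_Card_order[OF \<nu> False, THEN ordLess_imp_ordLeq]
    have "|I| \<le>o \<nu>" using I fin[of I] by argo
    moreover have "|\<N> i| \<le>o \<nu>" if "i \<in> I" for i using N(2)[OF that] fin[of "\<N> i"] by argo
    ultimately show ?thesis
      using card_of_UNION_ordLeq_infinite_Field[OF False \<nu>, of I \<N>] by simp
  qed
  moreover have "\<forall>N\<in>(\<Union>i\<in>I. \<N> i). nowhere_dense_in \<tau> N" using N(1) by simp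
  moreover have "(\<Union>i\<in>I. M i) \<subseteq> \<Union>(\<Union>i\<in>I. \<N> i)"
  proof (rule UN_least)
    fix i assume "i \<in> I"
    then have "\<Union>(\<N> i) \<subseteq> \<Union>(\<Union>i\<in>I. \<N> i)" by (intro Union_mono UN_upper)
    then show "M i \<subseteq> \<Union>(\<Union>i\<in>I. \<N> i)" using N(3)[OF \<open>i \<in> I\<close>] by (rule subset_trans[rotated])
  qed
  ultimately show ?thesis unfolding nu_meager_def by (intro exI conjI)
qed

lemma nu_meager_Un:
  assumes "Card_order \<nu>" and "nu_meager \<nu> \<tau> M" and "nu_meager \<nu> \<tau> M'"
  shows "nu_meager \<nu> \<tau> (M \<union> M')"
proof -
  have "nu_meager \<nu> \<tau> (\<Union>S\<in>{M, M'}. S)"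
    by (rule nu_meager_UN) (use assms in auto)
  then show ?thesis by simp
qed

lemma nu_meager_openin_empty:
  assumes \<kappa>: "Cinfinite \<kappa>" and B: "kappa_Baire \<kappa> \<tau>" and \<nu>: "\<nu> <o \<kappa>"
    and W: "openin \<tau> W" and M: "nu_meager \<nu> \<tau> W"
  shows "W = {}"
proof -
  obtain \<N> where N: "\<forall>N\<in>\<N>. nowhere_dense_in \<tau> N" "finite \<N> \<or> |\<N>| \<le>o \<nu>" "W \<subseteq> \<Union>\<N>"
    using M unfolding nu_meager_def by blast
  have "|\<N>| <o \<kappa>"
    using N(2)
  proof
    assume "finite \<N>"
    then show ?thesis
      using \<kappa> finite_ordLess_Card_order unfolding cinfinite_def by blast
  next
    assume "|\<N>| \<le>o \<nu>"
    then show ?thesis using \<nu> ordLeq_ordLess_trans by blast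
  qed
  then have "\<tau> closure_of (topspace \<tau> - \<Union>\<N>) = topspace \<tau>"
    using B N(1) unfolding kappa_Baire_def kappa_meager_def by blast
  moreover have "W \<inter> (topspace \<tau> - \<Union>\<N>) = {}" using N(3) by blast
  then have "W \<inter> \<tau> closure_of (topspace \<tau> - \<Union>\<N>) = {}"
    using W openin_Int_closure_of_eq_empty by metis
  ultimately show ?thesis using openin_subset[OF W] by blast
qed

section \<open>Closed approximations along a filtration\<close>

lemma closedin_coarser: "coarser \<sigma> \<tau> \<Longrightarrow> closedin \<sigma> F \<Longrightarrow> closedin \<tau> F"
  unfolding coarser_def closedin_def by auto

lemma ord0_le: "ord0 \<le> \<xi>"
  unfolding ord0_def by (rule Least_le) simp

lemma nowhere_dense_closed_boundary:
  assumes F: "closedin \<tau> F"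
  shows "nowhere_dense_in \<tau> (F - \<tau> interior_of F)"
proof -
  let ?D = "F - \<tau> interior_of F"
  have D: "closedin \<tau> ?D" using F by (simp add: closedin_diff)
  have "\<tau> interior_of ?D \<subseteq> ?D" by (rule interior_of_subset)
  moreover have "\<tau> interior_of ?D \<subseteq> \<tau> interior_of F" by (rule interior_of_mono) blast
  ultimately have "\<tau> interior_of ?D = {}" by blast
  then show ?thesis
    unfolding nowhere_dense_in_def using D closedin_subset[OF D] by (simp add: closure_of_closedin)
qed

text \<open>
  Complementation is where the level goes up: the complement of a \<open>T \<gamma>\<close>-closed set is corrected by
  a nowhere dense set so as to become closed in \<open>T \<xi>\<close>, for any later \<open>\<xi>\<close>.
\<close>

lemma complement_approx_closed:
  assumes \<nu>: "Card_order \<nu>" and fil: "filtration \<sigma> \<tau> I T" and I: "\<gamma> \<in> I" "\<xi> \<in> I" "\<gamma> < \<xi>"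
    and F: "closedin (T \<gamma>) F" and M: "nu_meager \<nu> \<tau> (sym_diff B F)"
  shows "\<exists>H. closedin (T \<xi>) H \<and> nu_meager \<nu> \<tau> (sym_diff (topspace \<tau> - B) H)"
proof (intro exI conjI)
  let ?H = "topspace \<tau> - \<tau> interior_of F"
  have "closedin \<tau> F"
    using fil I F closedin_coarser unfolding filtration_def by metis
  then have bd: "nowhere_dense_in \<tau> (F - \<tau> interior_of F)"
    by (rule nowhere_dense_closed_boundary)
  have "T \<xi> interior_of F = \<tau> interior_of F"
    using fil I F unfolding filtration_def by blast
  moreover have "topspace (T \<xi>) = topspace \<tau>"
    using fil I unfolding filtration_def coarser_def by blast
  ultimately show "closedin (T \<xi>) ?H"
    by (metis closedin_diff closedin_topspace openin_interior_of)
  have "nu_meager \<nu> \<tau> (sym_diff B F \<union> (F - \<tau> interior_of F))"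
    using nu_meager_Un[OF \<nu> M nu_meager_nowhere_dense[OF bd]] .
  moreover have "\<tau> interior_of F \<subseteq> F" by (rule interior_of_subset)
  ultimately show "nu_meager \<nu> \<tau> (sym_diff (topspace \<tau> - B) ?H)"
    by (elim nu_meager_subset) blast
qed

text \<open>
  The role of \<open>P\<^sup>\<nu>\<^sub>\<xi>\<close>: the Borel level \<open>\<xi>\<close> counted from \<open>\<sigma>\<close> is traded for the position \<open>\<xi>\<close> in the
  filtration, at the price of a meager error.
\<close>

lemma borel_P_approx_closed:
  assumes \<nu>: "Card_order \<nu>" and fil: "filtration \<sigma> \<tau> I T"
    and "{..\<xi>} \<subseteq> I" and "A \<in> borel_P \<sigma> \<nu> \<xi>"
  shows "\<exists>F. closedin (T \<xi>) F \<and> nu_meager \<nu> \<tau> (sym_diff A F)"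
  using assms(3,4)
proof (induction \<xi> arbitrary: A rule: less_induct)
  case (less \<xi>)
  show ?case
  proof (cases "\<xi> = ord0")
    case True
    then have "closedin (T \<xi>) A"
      using less.prems(2) fil by (simp add: borel_P.simps filtration_def)
    then show ?thesis by (intro exI[of _ A]) (simp add: nu_meager_empty)
  next
    case False
    let ?X = "topspace \<tau>"
    have X: "topspace (T \<xi>) = ?X" "topspace \<sigma> = ?X"
      using fil less.prems(1) ord0_le[of \<xi>] unfolding filtration_def coarser_def by auto
    obtain \<F> where A: "A = ?X \<inter> \<Inter>\<F>" and card: "|\<F>| \<le>o \<nu>"
      and \<F>: "\<F> \<subseteq> (\<lambda>B. ?X - B) ` (\<Union>\<gamma>\<in>{..<\<xi>}. borel_P \<sigma> \<nu> \<gamma>)"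
      using less.prems(2) False X by (subst (asm) borel_P.simps) auto
    have "\<exists>H. closedin (T \<xi>) H \<and> nu_meager \<nu> \<tau> (sym_diff C H)" if "C \<in> \<F>" for C
    proof -
      obtain B \<gamma> where C: "C = ?X - B" and \<gamma>: "\<gamma> < \<xi>" and B: "B \<in> borel_P \<sigma> \<nu> \<gamma>"
        using \<F> \<open>C \<in> \<F>\<close> by blast
      have sub: "{..\<gamma>} \<subseteq> I" using less.prems(1) \<gamma> by auto
      obtain F where "closedin (T \<gamma>) F" "nu_meager \<nu> \<tau> (sym_diff B F)"
        using less.IH[OF \<gamma> sub B] by blast
      then show ?thesis
        unfolding C using complement_approx_closed[OF \<nu> fil _ _ \<gamma>] sub less.prems(1) by blast
    qed
    then obtain H where H: "\<And>C. C \<in> \<F> \<Longrightarrow> closedin (T \<xi>) (H C)"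
      "\<And>C. C \<in> \<F> \<Longrightarrow> nu_meager \<nu> \<tau> (sym_diff C (H C))"
      by metis
    \<comment> \<open>Inserting the whole space covers the intersection of the empty family.\<close>
    have "closedin (T \<xi>) (\<Inter>(insert ?X (H ` \<F>)))"
      using H(1) X by (intro closedin_Inter) (auto simp flip: X(1))
    moreover have "nu_meager \<nu> \<tau> (\<Union>C\<in>\<F>. sym_diff C (H C))"
      by (rule nu_meager_UN[OF \<nu> disjI2[OF card] H(2)])
    then have "nu_meager \<nu> \<tau> (sym_diff A (\<Inter>(insert ?X (H ` \<F>))))"
      by (rule nu_meager_subset) (use A in auto)
    ultimately show ?thesis by blast
  qed
qed

section \<open>Regular open sets are captured by the filtration\<close>

text \<open>
  The \<open>\<kappa>\<close>-Baire property turns the approximation up to meager sets into honest inclusions between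
  \<open>\<tau>\<close>-open sets, and regularity of \<open>U\<close> absorbs the closure that is lost on the way.
\<close>

lemma regular_open_filtration_neighborhood:
  fixes \<alpha> :: "'i::wellorder" and \<kappa> :: "'k rel"
  assumes \<kappa>: "Cinfinite \<kappa>" and B: "kappa_Baire \<kappa> \<tau>"
    and nb: "neighborhood_basis \<tau> \<A>" and \<A>: "\<A> \<subseteq> (\<Union>\<xi>\<in>{..<\<alpha>}. borel_Pi \<kappa> \<sigma> \<xi>)"
    and fil: "filtration \<sigma> \<tau> I T" and I: "{..<\<alpha>} \<subseteq> I"
    and cofinal: "\<And>\<xi>. \<xi> < \<alpha> \<Longrightarrow> \<exists>\<eta>\<in>I. \<xi> < \<eta>"
    and U: "regular_openin \<tau> U" and x: "x \<in> U"
  shows "\<exists>\<eta>\<in>I. \<exists>V. openin (T \<eta>) V \<and> x \<in> V \<and> V \<subseteq> U"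
proof -
  have Uo: "openin \<tau> U" using U unfolding regular_openin_def by (metis openin_interior_of)
  obtain A where A: "A \<in> \<A>" "x \<in> \<tau> interior_of A" "A \<subseteq> U"
    using nb x Uo openin_subset[OF Uo] unfolding neighborhood_basis_def by blast
  then have AX: "A \<subseteq> topspace \<tau>" using openin_subset[OF Uo] by blast
  obtain \<xi> and \<nu> :: "'k rel" where \<xi>: "\<xi> < \<alpha>" and \<nu>: "Card_order \<nu>" "\<nu> <o \<kappa>"
    and P: "A \<in> borel_P \<sigma> \<nu> \<xi>"
    using A(1) \<A> unfolding borel_Pi_def by blast
  have "{..\<xi>} \<subseteq> I" using \<xi> I by auto
  then obtain F where F: "closedin (T \<xi>) F" and M: "nu_meager \<nu> \<tau> (sym_diff A F)"
    using borel_P_approx_closed[OF \<nu>(1) fil _ P] by blast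
  have Fc: "closedin \<tau> F"
    using fil \<xi> I F closedin_coarser unfolding filtration_def by (metis lessThan_iff subsetD)
  \<comment> \<open>An open subset of the error set between \<open>A\<close> and \<open>F\<close> is empty. This is used once on each side.\<close>
  note empty = nu_meager_openin_empty[OF \<kappa> B \<nu>(2) _ nu_meager_subset[OF M]]
  have "\<tau> interior_of A - F = {}"
    using interior_of_subset[of \<tau> A] Fc by (intro empty) (auto intro: openin_diff)
  then have AF: "\<tau> interior_of A \<subseteq> \<tau> interior_of F"
    by (simp add: interior_of_maximal)
  have "\<tau> interior_of F - \<tau> closure_of A = {}"
    using interior_of_subset[of \<tau> F] closure_of_subset[OF AX]
    by (intro empty) (auto intro: openin_diff)
  then have "\<tau> interior_of F \<subseteq> \<tau> closure_of U"
    using closure_of_mono[OF A(3), of \<tau>] by blast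
  then have FU: "\<tau> interior_of F \<subseteq> U"
    using U unfolding regular_openin_def by (metis interior_of_maximal openin_interior_of)
  obtain \<eta> where \<eta>: "\<eta> \<in> I" "\<xi> < \<eta>" using cofinal[OF \<xi>] by blast
  then have "T \<eta> interior_of F = \<tau> interior_of F"
    using fil F unfolding filtration_def by blast
  then have "openin (T \<eta>) (\<tau> interior_of F)" by (metis openin_interior_of)
  then show ?thesis using \<eta> A(2) AF FU by blast
qed

lemma openin_topology_generated_by_coarsest:
  assumes "openin (topology_generated_by \<S>) U" and "\<And>S. S \<in> \<S> \<Longrightarrow> openin \<tau> S"
  shows "openin \<tau> U"
  using generate_topology_on_coarsest[OF istopology_openin assms(2)
      openin_topology_generated_by[OF assms(1)]] .

lemma semiregular_eqI:
  assumes "semiregular \<tau>" and "\<And>U. openin \<tau>' U \<Longrightarrow> openin \<tau> U"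
    and "\<And>U x. regular_openin \<tau> U \<Longrightarrow> x \<in> U \<Longrightarrow> \<exists>V. openin \<tau>' V \<and> x \<in> V \<and> V \<subseteq> U"
  shows "\<tau> = \<tau>'"
proof -
  have "openin \<tau>' U" if "regular_openin \<tau> U" for U
    using assms(3)[OF that] by (subst openin_subopen) blast
  then have "openin \<tau>' U" if "openin \<tau> U" for U
    using that assms(1) openin_topology_generated_by_coarsest[of "{U. regular_openin \<tau> U}" U \<tau>']
    unfolding semiregular_def by simp
  then show ?thesis using assms(2) unfolding topology_eq by blast
qed

lemma openin_topology_joinI:
  assumes "\<tau> \<in> S" and "openin \<tau> U"
  shows "openin (topology_join X S) U"
  unfolding topology_join_def using assms by (intro topology_generated_by_Basis) blast

lemma openin_topology_joinD:
  assumes "openin (topology_join (topspace \<tau>) S) U" and "\<And>\<rho>. \<rho> \<in> S \<Longrightarrow> coarser \<rho> \<tau>"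
  shows "openin \<tau> U"
  using assms(1) unfolding topology_join_def
  by (rule openin_topology_generated_by_coarsest) (use assms(2) in \<open>auto simp: coarser_def\<close>)

section \<open>The end of a filtration\<close>

theorem theorem3p1:
  fixes \<sigma> \<tau> :: "'a topology"
    and \<kappa> :: "'k rel"
    and \<alpha> :: "'i::wellorder"
  assumes "coarser \<sigma> \<tau>"
    and "semiregular \<tau>"
    and "Cinfinite \<kappa>"
    and "kappa_Baire \<kappa> \<tau>"
    and "ord0 < \<alpha>" and "ord_rel \<alpha> \<le>o \<kappa>"
    and "\<exists>\<A>. neighborhood_basis \<tau> \<A> \<and> \<A> \<subseteq> (\<Union>\<xi>\<in>{..<\<alpha>}. borel_Pi \<kappa> \<sigma> \<xi>)"
  shows "(\<forall>T. successor_ord \<alpha> \<and> filtration \<sigma> \<tau> {..\<alpha>} T \<longrightarrow> \<tau> = T \<alpha>) \<and>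
    (\<forall>T. limit_ord \<alpha> \<and> filtration \<sigma> \<tau> {..<\<alpha>} T \<longrightarrow>
      \<tau> = topology_join (topspace \<tau>) (T ` {..<\<alpha>}))"
proof (intro conjI allI impI)
  obtain \<A> where \<A>: "neighborhood_basis \<tau> \<A>" "\<A> \<subseteq> (\<Union>\<xi>\<in>{..<\<alpha>}. borel_Pi \<kappa> \<sigma> \<xi>)"
    using assms(7) by blast
  note nbhd = regular_open_filtration_neighborhood[OF assms(3,4) \<A>]
  {
    fix T assume "successor_ord \<alpha> \<and> filtration \<sigma> \<tau> {..\<alpha>} T"
    then have fil: "filtration \<sigma> \<tau> {..\<alpha>} T" ..
    show "\<tau> = T \<alpha>"
    proof (rule semiregular_eqI[OF assms(2)])
      show "openin \<tau> U" if "openin (T \<alpha>) U" for U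
        using fil that unfolding filtration_def coarser_def by blast
      fix U x assume "regular_openin \<tau> U" "x \<in> U"
      then obtain \<eta> V where "\<eta> \<le> \<alpha>" and V: "openin (T \<eta>) V" "x \<in> V" "V \<subseteq> U"
        using nbhd[OF fil] by (metis atMost_iff lessThan_subset_iff order_refl
            less_imp_le lessThan_iff subsetI)
      then have "openin (T \<alpha>) V"
        using fil unfolding filtration_def coarser_def by (metis atMost_iff order_refl)
      then show "\<exists>V. openin (T \<alpha>) V \<and> x \<in> V \<and> V \<subseteq> U" using V by blast
    qed
  next
    fix T assume "limit_ord \<alpha> \<and> filtration \<sigma> \<tau> {..<\<alpha>} T"
    then have lim: "limit_ord \<alpha>" and fil: "filtration \<sigma> \<tau> {..<\<alpha>} T" by auto
    have cofinal: "\<exists>\<eta>\<in>{..<\<alpha>}. \<xi> < \<eta>" if "\<xi> < \<alpha>" for \<xi>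
      using lim that unfolding limit_ord_def successor_ord_def by (meson lessThan_iff not_le)
    show "\<tau> = topology_join (topspace \<tau>) (T ` {..<\<alpha>})"
    proof (rule semiregular_eqI[OF assms(2)])
      show "openin \<tau> U" if "openin (topology_join (topspace \<tau>) (T ` {..<\<alpha>})) U" for U
        using that by (rule openin_topology_joinD) (use fil in \<open>auto simp: filtration_def\<close>)
      fix U x assume "regular_openin \<tau> U" "x \<in> U"
      then show "\<exists>V. openin (topology_join (topspace \<tau>) (T ` {..<\<alpha>})) V \<and> x \<in> V \<and> V \<subseteq> U"
        using nbhd[OF fil order_refl cofinal] openin_topology_joinI by (metis imageI)
    qed
  }
qed

end
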